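(* Let $g$ lie in $\mathcal{C}^0\cap\mathcal{D}^p\cap\mathcal{K}^p$ for some $p\in\mathbb{N}$. Then both functions $J^{p+1}[\Sigma g]$ and $J^p[g]$ vanish at infinity. More precisely, $$\Sigma g(x)-\int_1^x g(t)\,dt+\sum_{j=1}^pG_j\,\Delta^{j-1}g(x)\ \to\ \sigma[g]\qquad\text{as }x\to\infty$$ and $$\int_x^{x+1}g(t)\,dt-\sum_{j=0}^{p-1}G_j\,\Delta^jg(x)\ \to\ 0\qquad\text{as }x\to\infty.$$
   Context: $\mathbb{N}=\{0,1,2,\ldots\}$, $\mathbb{R}_+=(0,\infty)$, $\Delta f(x)=f(x+1)-f(x)$; $\mathcal{C}^0$ is the set of continuous functions $\mathbb{R}_+\to\mathbb{R}$. For an integer $p\ge -1$, a function $f\colon I\to\mathbb{R}$ on a real interval $I$ is $p$-convex (resp. $p$-concave) if for all $x_0<\cdots<x_{p+1}$ in $I$ the divided difference $f[x_0,\ldots,x_{p+1}]$ is $\ge 0$ (resp. $\le 0$), where $f[x_0,\ldots,x_n]=\sum_{k=0}^n f(x_k)/\prod_{j\ne k}(x_k-x_j)$. $\mathcal{K}^p$ is the set of functions $\mathbb{R}_+\to\mathbb{R}$ that are $p$-convex on some $[a,\infty)$ or $p$-concave on some $[a,\infty)$. $\mathcal{D}^p$ is the set of $g\colon\mathbb{R}_+\to\mathbb{R}$ with $\Delta^pg(n)\to 0$ as $n\to\infty$ over the integers. For $g\in\mathcal{D}^p\cap\mathcal{K}^p$, the function $\Sigma g\colon\mathbb{R}_+\to\mathbb{R}$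 is $$\Sigma g(x)=\lim_{n\to\infty}\Big(-g(x)+\sum_{k=1}^{n-1}(g(k)-g(x+k))+\sum_{j=1}^p\binom{x}{j}\Delta^{j-1}g(n)\Big);$$ the limit exists, does not depend on the choice of such $p$, $\Sigma g$ is the unique solution $f\in\mathcal{K}^p$ of $\Delta f=g$ with $f(1)=0$, and $\Sigma g$ is continuous if $g$ is. Gregory coefficients: $G_n=\int_0^1\binom{t}{n}\,dt$. Asymptotic constant: $\sigma[g]=\int_0^1\Sigma g(t+1)\,dt$. Generalized Binet function: for continuous $f\colon\mathbb{R}_+\to\mathbb{R}$ and $q\in\mathbb{N}$, $J^q[f](x)=\sum_{j=0}^{q-1}G_j\Delta^jf(x)-\int_x^{x+1}f(t)\,dt$, $x>0$. *)

theory Defs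
  imports "HOL-Analysis.Analysis"
begin

(* Functions on the open half-line (0, oo) are represented by total functions real => real.
   All definitions below use values at positive arguments only, as long as they are
   themselves evaluated at positive arguments. *)

definition fdiff :: "(real \<Rightarrow> real) \<Rightarrow> real \<Rightarrow> real" where
  "fdiff f x = f (x + 1) - f x"

(* f[x 0, ..., x n]; meaningful only if x 0, ..., x n are pairwise distinct *)
definition divided_difference :: "(real \<Rightarrow> real) \<Rightarrow> (nat \<Rightarrow> real) \<Rightarrow> nat \<Rightarrow> real" where
  "divided_difference f x n = (\<Sum>k\<le>n. f (x k) / (\<Prod>j\<in>{..n} - {k}. x k - x j))"

(* Higher-order convexity and concavity for orders p >= 0 (the order -1, i.e. sign conditions
   on f itself, is left out); p = 0 is monotonicity, p = 1 is ordinary convexity. *)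
definition p_convex_on :: "nat \<Rightarrow> real set \<Rightarrow> (real \<Rightarrow> real) \<Rightarrow> bool" where
  "p_convex_on p I f \<longleftrightarrow>
     (\<forall>x. strict_mono_on {..p+1} x \<and> x ` {..p+1} \<subseteq> I \<longrightarrow> divided_difference f x (p+1) \<ge> 0)"

definition p_concave_on :: "nat \<Rightarrow> real set \<Rightarrow> (real \<Rightarrow> real) \<Rightarrow> bool" where
  "p_concave_on p I f \<longleftrightarrow>
     (\<forall>x. strict_mono_on {..p+1} x \<and> x ` {..p+1} \<subseteq> I \<longrightarrow> divided_difference f x (p+1) \<le> 0)"

definition K_class :: "nat \<Rightarrow> (real \<Rightarrow> real) set" where
  "K_class p = {f. \<exists>a>0. p_convex_on p {a..} f \<or> p_concave_on p {a..} f}"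

definition D_class :: "nat \<Rightarrow> (real \<Rightarrow> real) set" where
  "D_class p = {g. (\<lambda>n::nat. (fdiff ^^ p) g (real n)) \<longlonglongrightarrow> 0}"

definition indef_sum_seq :: "nat \<Rightarrow> (real \<Rightarrow> real) \<Rightarrow> real \<Rightarrow> nat \<Rightarrow> real" where
  "indef_sum_seq p g x n =
     - g x + (\<Sum>k=1..<n. g (real k) - g (x + real k))
       + (\<Sum>j=1..p. (x gchoose j) * (fdiff ^^ (j - 1)) g (real n))"

(* The function Sigma g.  For g in D_class p and K_class p the limit does not depend on the
   choice of such p, so an arbitrary admissible p is picked; this makes Sigma g depend on g only. *)
definition indef_sum :: "(real \<Rightarrow> real) \<Rightarrow> real \<Rightarrow> real" where
  "indef_sum g x = lim (indef_sum_seq (SOME p. g \<in> D_class p \<inter> K_class p) g x)"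

definition gregory :: "nat \<Rightarrow> real" where
  "gregory n = integral {0..1} (\<lambda>t. t gchoose n)"

definition asymptotic_constant :: "(real \<Rightarrow> real) \<Rightarrow> real" where
  "asymptotic_constant g = integral {0..1} (\<lambda>t. indef_sum g (t + 1))"

definition gen_binet :: "nat \<Rightarrow> (real \<Rightarrow> real) \<Rightarrow> real \<Rightarrow> real" where
  "gen_binet q f x = (\<Sum>j<q. gregory j * (fdiff ^^ j) f x) - integral {x..x+1} f"

end

theory Submission
  imports Defs "HOL-Computational_Algebra.Polynomial"
begin

text \<open>
  Write \<open>\<Delta>\<close> for the forward difference and let \<open>R\<^sub>k(y, t)\<close> be the error at \<open>y + t\<close> of the Newton
  polynomial that interpolates \<open>f\<close> at the nodes \<open>y, y + 1, \<dots>, y + k - 1\<close>. Integrating that polynomial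
  over \<open>0 \<le> t \<le> 1\<close> produces exactly the Gregory coefficients, so \<open>J\<^sup>k[f](y)\<close> is minus the integral of
  \<open>R\<^sub>k(y, t)\<close> over the unit interval, and everything comes down to uniform smallness of \<open>R\<^sub>k(y, t)\<close> for
  \<open>0 \<le> t \<le> 1\<close> as \<open>y\<close> grows.

  The engine is one inequality: if \<open>f\<close> is \<open>p\<close>-convex far out, then
  \<open>\<bar>R\<^bsub>p+1\<^esub>(y, t)\<bar> \<le> \<Delta>\<^sup>p f(y + 1) - \<Delta>\<^sup>p f(y - 1)\<close>
  (\<open>p_convex_on_newton_remainder_bound\<close>). For \<open>p \<ge> 1\<close> it follows by looking at \<open>y + t\<close> from the two
  bases \<open>y\<close> and \<open>y - 1\<close>. The sign of \<open>R\<close> is known from the sign of a divided difference; the two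
  remainders have opposite signs, and they differ by \<open>(t choose p) (\<Delta>\<^sup>p f(y) - \<Delta>\<^sup>p f(y - 1))\<close>, which
  therefore bounds both.

  For \<open>g\<close> in \<open>D\<^sup>p\<close> and \<open>K\<^sup>p\<close> the bound tends to zero, first along the integers and then along the reals
  (\<open>funpow_fdiff_tendsto_0\<close>), which settles \<open>J\<^sup>p[g]\<close>.

  For \<open>S = \<Sigma>g\<close>, consecutive terms of the defining sequence differ by \<open>- R\<^bsub>p+1\<^esub>(n, x)\<close>, and the bound
  telescopes; hence the limit exists and \<open>\<Delta>S = g\<close>. As a limit of sums of translates of \<open>- g\<close> and
  polynomials of degree at most \<open>p\<close>, the function \<open>S\<close> belongs to \<open>K\<^sup>p\<close> too, with the opposite orientation.
  So the same inequality applies to \<open>S\<close> with the same \<open>p\<close>, and its right-hand side is, up to sign,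
  \<open>\<Delta>\<^sup>p g(y) + \<Delta>\<^sup>p g(y - 1)\<close>, which tends to zero. This gives both the continuity of \<open>S\<close>
  and \<open>J\<^bsup>p+1\<^esup>[S] \<rightarrow> 0\<close>. The expansion of \<open>S\<close> is a restatement, because the integral of \<open>S\<close> over
  \<open>[x, x + 1]\<close> equals \<open>\<sigma>[g]\<close> plus the integral of \<open>g\<close> over \<open>[1, x]\<close>.

  The order \<open>q\<close> that the definition of \<open>\<Sigma>g\<close> picks need not be \<open>p\<close>. It makes no difference in the
  limit, since all \<open>\<Delta>\<^sup>j g\<close> with \<open>j \<ge> min p q\<close> vanish at infinity.
\<close>

section \<open>Newton interpolation on unit-spaced nodes\<close>

definition newton_remainder :: "(real \<Rightarrow> real) \<Rightarrow> nat \<Rightarrow> real \<Rightarrow> real \<Rightarrow> real" where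
  "newton_remainder g k y t = g (y + t) - (\<Sum>j<k. (t gchoose j) * (fdiff ^^ j) g y)"

lemma funpow_fdiff_Suc: "(fdiff ^^ Suc j) g x = (fdiff ^^ j) g (x + 1) - (fdiff ^^ j) g x"
  by (simp add: fdiff_def)

lemma funpow_fdiff_fdiff: "(fdiff ^^ j) (fdiff g) = (fdiff ^^ Suc j) g"
  by (simp add: funpow_swap1)

lemma funpow_fdiff_cmult: "(fdiff ^^ j) (\<lambda>x. c * g x) x = c * (fdiff ^^ j) g x"
proof (induction j arbitrary: x)
  case (Suc j)
  then show ?case by (simp add: funpow_fdiff_Suc algebra_simps del: funpow.simps(2))
qed simp

lemma newton_remainder_cmult:
  "newton_remainder (\<lambda>x. c * g x) k y t = c * newton_remainder g k y t"
  by (simp add: newton_remainder_def funpow_fdiff_cmult algebra_simps sum_distrib_left)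

lemma newton_remainder_Suc:
  "newton_remainder g (Suc k) y t = newton_remainder g k y t - (t gchoose k) * (fdiff ^^ k) g y"
  by (simp add: newton_remainder_def)

text \<open>The point \<open>y + 1 + t\<close> can be approximated from the base \<open>y\<close> or from the base \<open>y + 1\<close>. The two
  interpolating polynomials share the nodes \<open>y + 1, \<dots>, y + k\<close>, so they differ by a multiple of
  \<open>t choose k\<close>. Comparing the two bases is what drives all estimates below.\<close>
lemma newton_remainder_add_one:
  "newton_remainder g (Suc k) y (t + 1) =
     newton_remainder g (Suc k) (y + 1) t
     + (t gchoose k) * ((fdiff ^^ k) g (y + 1) - (fdiff ^^ k) g y)"
proof (induction k)
  case 0
  then show ?case by (simp add: newton_remainder_def algebra_simps)
next
  case (Suc k)
  have "newton_remainder g (Suc (Suc k)) y (t + 1)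
    = newton_remainder g (Suc k) y (t + 1) - (t + 1 gchoose Suc k) * (fdiff ^^ Suc k) g y"
    by (rule newton_remainder_Suc)
  also have "\<dots> = newton_remainder g (Suc k) (y + 1) t - (t gchoose Suc k) * (fdiff ^^ Suc k) g y"
    unfolding Suc.IH gbinomial_Suc_Suc by (simp add: fdiff_def ring_distribs)
  also have "\<dots> = newton_remainder g (Suc (Suc k)) (y + 1) t
    + (t gchoose Suc k) * ((fdiff ^^ Suc k) g (y + 1) - (fdiff ^^ Suc k) g y)"
    unfolding newton_remainder_Suc[of _ "Suc k"] by (simp only: algebra_simps)
  finally show ?case .
qed

text \<open>The Newton polynomial does interpolate: each unit step moves the base, and the correction
  \<open>m choose l\<close> is zero as long as \<open>m < l\<close>.\<close>
lemma newton_remainder_at_nat: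
  assumes "m < k"
  shows "newton_remainder g k y (real m) = 0"
  using assms
proof (induction m arbitrary: y k)
  case 0
  then obtain l where "k = Suc l" by (cases k) auto
  then show ?case
    by (simp only: newton_remainder_def sum.lessThan_Suc_shift) simp
next
  case (Suc m)
  then obtain l where k: "k = Suc l" "m < l" by (cases k) auto
  have "(real m gchoose l) = 0"
    using k(2) by (simp flip: binomial_gbinomial)
  then show ?case
    using newton_remainder_add_one[of g l y "real m"] Suc.IH[of k "y + 1"] k
    by (simp add: add.commute)
qed

text \<open>Differencing in \<open>t\<close> turns the remainder of \<open>g\<close> into that of \<open>\<Delta>g\<close> with one node fewer, and
  the preceding base change expresses this through remainders of \<open>g\<close> at the same \<open>t\<close>. Smallness on
  \<open>0 \<le> t \<le> 1\<close> thus passes from \<open>g\<close> to \<open>\<Delta>g\<close>.\<close>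
lemma newton_remainder_fdiff:
  "newton_remainder (fdiff g) k y t =
     newton_remainder g (Suc k) (y + 1) t - newton_remainder g (Suc k) y t
     + (t gchoose k) * ((fdiff ^^ k) g (y + 1) - (fdiff ^^ k) g y)"
proof -
  have "newton_remainder g (Suc k) y (t + 1) - newton_remainder g (Suc k) y t
      = newton_remainder (fdiff g) k y t"
    unfolding newton_remainder_def sum.lessThan_Suc_shift gbinomial_Suc_Suc funpow_fdiff_fdiff
    by (simp add: fdiff_def algebra_simps sum.distrib sum_subtractf)
  then show ?thesis
    using newton_remainder_add_one[of g k y t] by simp
qed

section \<open>Divided differences and the sign of the remainder\<close>

text \<open>Divided differences are symmetric in their nodes, and indexing them by the set of nodes avoids
  having to sort a node \<open>y + s\<close> into its place among \<open>y, y + 1, \<dots>, y + p\<close>.\<close>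
definition set_divided_difference :: "(real \<Rightarrow> real) \<Rightarrow> real set \<Rightarrow> real" where
  "set_divided_difference f S = (\<Sum>x\<in>S. f x / (\<Prod>z\<in>S - {x}. x - z))"

lemma divided_difference_eq_set:
  assumes "inj_on x {..n}"
  shows "divided_difference f x n = set_divided_difference f (x ` {..n})"
proof -
  have "(\<Prod>z\<in>x ` {..n} - {x k}. x k - z) = (\<Prod>j\<in>{..n} - {k}. x k - x j)" if "k \<le> n" for k
  proof -
    have "x ` {..n} - {x k} = x ` ({..n} - {k})"
      using assms that by (auto simp: inj_on_def)
    moreover have "inj_on x ({..n} - {k})"
      using assms by (rule inj_on_subset) auto
    ultimately show ?thesis by (simp add: prod.reindex)
  qed
  then show ?thesis
    by (simp add: divided_difference_def set_divided_difference_def sum.reindex[OF assms])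
qed

lemma p_convex_on_set_divided_difference:
  assumes "p_convex_on p I f" "finite S" "S \<subseteq> I" "card S = p + 2"
  shows "set_divided_difference f S \<ge> 0"
proof -
  define x where "x = (\<lambda>i. sorted_list_of_set S ! i)"
  have len: "length (sorted_list_of_set S) = p + 2"
    using assms by simp
  have mono: "strict_mono_on {..p+1} x"
    using strict_sorted_list_of_set[of S] len
    by (auto simp: strict_mono_on_def x_def sorted_wrt_iff_nth_less)
  have "x ` {..p+1} = set (sorted_list_of_set S)"
    unfolding x_def set_conv_nth len by (auto simp: image_iff less_Suc_eq_le)
  then have im: "x ` {..p+1} = S"
    using assms(2) by simp
  have "divided_difference f x (p + 1) \<ge> 0"
    using assms(1,3) mono im unfolding p_convex_on_def by blast
  then show ?thesis
    using divided_difference_eq_set[of x "p + 1" f] mono im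
    by (simp add: strict_mono_on_imp_inj_on)
qed

text \<open>The divided difference is the coefficient of degree \<open>card S - 1\<close> of the Lagrange interpolation
  polynomial on \<open>S\<close>, and a polynomial of smaller degree is its own interpolation polynomial.\<close>
lemma set_divided_difference_poly_eq_0:
  assumes "finite S" "degree q + 1 < card S"
  shows "set_divided_difference (poly q) S = 0"
proof -
  define w where "w x = (\<Prod>z\<in>S - {x}. x - z)" for x
  define l where "l x = (\<Prod>z\<in>S - {x}. [:- z, 1:])" for x
  define L where "L = (\<Sum>x\<in>S. smult (poly q x / w x) (l x))"
  have w_nz: "w x \<noteq> 0" for x
    using assms(1) by (auto simp: w_def)
  have l_self: "poly (l x) x = w x" for x
    by (simp add: l_def w_def poly_prod)
  have l_other: "poly (l x) z = 0" if "z \<in> S" "z \<noteq> x" for x z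
    using that assms(1) by (auto simp: l_def poly_prod)
  have deg_l: "degree (l x) = card S - 1" "lead_coeff (l x) = 1" if "x \<in> S" for x
  proof -
    show "degree (l x) = card S - 1"
      using that assms(1) unfolding l_def by (subst degree_prod_eq_sum_degree) (auto simp: card_Diff_singleton)
    show "lead_coeff (l x) = 1"
      unfolding l_def by (simp add: lead_coeff_prod)
  qed
  have agree: "poly (q - L) x = 0" if "x \<in> S" for x
  proof -
    have "poly L x = (\<Sum>z\<in>S. if z = x then poly q x else 0)"
      unfolding L_def poly_sum by (rule sum.cong) (use that w_nz l_self l_other in auto)
    then show ?thesis using that assms(1) by simp
  qed
  have "q - L = 0"
  proof (rule ccontr)
    assume nz: "q - L \<noteq> 0"
    have "degree L \<le> card S - 1"
      unfolding L_def by (rule degree_sum_le) (use assms(1) deg_l in \<open>auto intro: order_trans[OF degree_smult_le]\<close>)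
    then have "degree (q - L) \<le> card S - 1"
      using assms(2) by (intro degree_diff_le) auto
    moreover have "card S \<le> card {x. poly (q - L) x = 0}"
      using agree poly_roots_finite[OF nz] by (intro card_mono) auto
    ultimately show False
      using card_poly_roots_bound[OF nz] assms(2) by linarith
  qed
  then have "coeff L (card S - 1) = 0"
    using assms(2) by (simp add: coeff_eq_0)
  moreover have "coeff L (card S - 1) = (\<Sum>x\<in>S. poly q x / w x)"
    unfolding L_def coeff_sum using deg_l by (intro sum.cong) auto
  ultimately show ?thesis
    by (simp add: set_divided_difference_def w_def)
qed

lemma set_divided_difference_diff:
  "set_divided_difference (\<lambda>x. f x - h x) S = set_divided_difference f S - set_divided_difference h S"
  by (simp add: set_divided_difference_def diff_divide_distrib sum_subtractf)

lemma gbinomial_shift_poly: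
  obtains q :: "real poly" where "degree q \<le> j" "\<And>x. poly q x = (x - y) gchoose j"
proof
  let ?q = "smult (inverse (fact j)) (\<Prod>i<j. [:- y - real i, 1:])"
  show "degree ?q \<le> j"
    by (intro order_trans[OF degree_smult_le] order_trans[OF degree_prod_sum_le]) auto
  show "poly ?q x = (x - y) gchoose j" for x
    by (simp add: poly_prod gbinomial_prod_rev atLeast0LessThan field_simps)
qed

lemma gbinomial_sum_shift_poly:
  obtains q :: "real poly" where "degree q \<le> k"
    "\<And>x. poly q x = (\<Sum>j\<le>k. ((x - y) gchoose j) * c j)"
proof -
  have "\<exists>q :: real poly. degree q \<le> j \<and> (\<forall>x. poly q x = (x - y) gchoose j)" for j
    by (rule gbinomial_shift_poly[of j y]) auto
  then obtain b :: "nat \<Rightarrow> real poly"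
    where b: "\<And>j. degree (b j) \<le> j" "\<And>j x. poly (b j) x = (x - y) gchoose j"
    by metis
  show thesis
  proof
    show "degree (\<Sum>j\<le>k. smult (c j) (b j)) \<le> k"
      by (rule degree_sum_le) (use b(1) in \<open>auto intro!: order_trans[OF degree_smult_le] intro: order_trans\<close>)
    show "poly (\<Sum>j\<le>k. smult (c j) (b j)) x = (\<Sum>j\<le>k. ((x - y) gchoose j) * c j)" for x
      by (simp add: poly_sum b(2) mult.commute)
  qed
qed

text \<open>Subtracting the Newton polynomial, which has degree at most \<open>p\<close>, leaves the divided difference
  on \<open>{y, \<dots>, y + p, y + s}\<close> unchanged and makes the function zero at every node but \<open>y + s\<close>. Hence
  the remainder is this divided difference times \<open>s (s - 1) \<cdots> (s - p)\<close>.\<close>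
lemma newton_remainder_gbinomial_nonneg:
  assumes conv: "p_convex_on p {a..} g" and y: "a \<le> y" and s: "s > 0"
  shows "newton_remainder g (Suc p) y s * (s gchoose Suc p) \<ge> 0"
proof (cases "s \<in> real ` {..p}")
  case True
  then show ?thesis
    using newton_remainder_at_nat[of _ "Suc p" g y] by auto
next
  case False
  define N where "N = (\<lambda>i. y + real i) ` {..p}"
  define S where "S = insert (y + s) N"
  have notin: "y + s \<notin> N"
    using False by (auto simp: N_def)
  have inj: "inj_on (\<lambda>i. y + real i) {..p}"
    by (auto simp: inj_on_def)
  have S: "finite S" "S \<subseteq> {a..}" "card S = p + 2"
    using notin y s inj by (auto simp: S_def N_def card_image)
  obtain q :: "real poly" where q: "degree q \<le> p"
    "\<And>x. poly q x = (\<Sum>j\<le>p. ((x - y) gchoose j) * (fdiff ^^ j) g y)"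
    using gbinomial_sum_shift_poly[of p y "\<lambda>j. (fdiff ^^ j) g y"] by blast
  have rem: "g x - poly q x = newton_remainder g (Suc p) y (x - y)" for x
    by (simp add: q newton_remainder_def lessThan_Suc_atMost)
  have "0 \<le> set_divided_difference g S"
    by (rule p_convex_on_set_divided_difference[OF conv S])
  also have "\<dots> = set_divided_difference (\<lambda>x. g x - poly q x) S"
    using set_divided_difference_poly_eq_0[of S q] q(1) S by (simp add: set_divided_difference_diff)
  also have "\<dots> = (g (y + s) - poly q (y + s)) / (\<Prod>z\<in>S - {y + s}. y + s - z)"
  proof -
    have "g x - poly q x = 0" if "x \<in> N" for x
      using that newton_remainder_at_nat[of _ "Suc p" g y] unfolding rem by (auto simp: N_def)
    then show ?thesis
      using notin by (simp add: set_divided_difference_def S_def N_def)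
  qed
  also have "S - {y + s} = N"
    using notin by (auto simp: S_def)
  also have "(\<Prod>z\<in>N. y + s - z) = (\<Prod>i<Suc p. s - real i)"
    using inj by (simp add: N_def prod.reindex lessThan_Suc_atMost)
  also have "\<dots> = (s gchoose Suc p) * fact (Suc p)"
    by (simp add: gbinomial_prod_rev atLeast0LessThan del: fact_Suc prod.lessThan_Suc)
  finally have "0 \<le> newton_remainder g (Suc p) y s / ((s gchoose Suc p) * fact (Suc p))"
    unfolding rem by simp
  then show ?thesis
    using fact_gt_zero[of "Suc p", where 'a = real]
    by (auto simp: zero_le_divide_iff zero_le_mult_iff mult_le_0_iff not_le simp del: fact_Suc)
qed

section \<open>The remainder estimate\<close>

lemma abs_gbinomial_le_1:
  fixes t :: real
  assumes "t \<in> {0..1}"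
  shows "\<bar>t gchoose k\<bar> \<le> 1"
proof (induction k)
  case (Suc k)
  have "(t gchoose Suc k) = (t gchoose k) * ((t - real k) / real (Suc k))"
    using gbinomial_mult_1[of t k] by (simp add: field_simps)
  moreover have "\<bar>(t - real k) / real (Suc k)\<bar> \<le> 1"
    using assms by (simp add: field_simps abs_le_iff)
  ultimately show ?case
    using mult_mono[OF Suc] by (simp add: abs_mult)
qed simp

lemma p_convex_on_funpow_fdiff_mono:
  assumes "p_convex_on p {a..} g" "a \<le> y"
  shows "(fdiff ^^ p) g y \<le> (fdiff ^^ p) g (y + 1)"
proof -
  have "newton_remainder g (Suc p) y (real p + 1) = (fdiff ^^ p) g (y + 1) - (fdiff ^^ p) g y"
    using newton_remainder_at_nat[of p "Suc p" g "y + 1"]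
    by (simp add: newton_remainder_add_one flip: binomial_gbinomial)
  moreover have "(real p + 1) gchoose Suc p = 1"
    using binomial_gbinomial[of "Suc p" "Suc p", where ?'a = real] by (simp add: add.commute)
  ultimately show ?thesis
    using newton_remainder_gbinomial_nonneg[OF assms, of "real p + 1"] by simp
qed

text \<open>Let \<open>0 < t < 1\<close>, \<open>p \<ge> 1\<close> and \<open>c = t choose p\<close>. The binomials that govern the signs at the bases \<open>y\<close>
  and \<open>y - 1\<close> are \<open>c (t - p) / (p + 1)\<close> and \<open>c (t + 1) / (p + 1)\<close>, which have opposite signs, so zero
  lies between the remainder \<open>R\<close> from \<open>y\<close> and the remainder \<open>R + c d\<close> from \<open>y - 1\<close>, where
  \<open>d = \<Delta>\<^sup>p g(y) - \<Delta>\<^sup>p g(y - 1)\<close>. For \<open>p = 0\<close> the function is monotone and the value at \<open>y + 1\<close> is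
  needed for an upper bound; the right-hand side covers both cases.\<close>
lemma p_convex_on_newton_remainder_bound:
  assumes conv: "p_convex_on p {a..} g" and y: "a + 1 \<le> y" and t: "t \<in> {0..1}"
  shows "\<bar>newton_remainder g (Suc p) y t\<bar> \<le> (fdiff ^^ p) g (y + 1) - (fdiff ^^ p) g (y - 1)"
proof -
  let ?E = "(fdiff ^^ p) g" and ?R = "newton_remainder g (Suc p) y t"
  have mono: "?E (y - 1) \<le> ?E y" "?E y \<le> ?E (y + 1)"
    using p_convex_on_funpow_fdiff_mono[OF conv, of "y - 1"]
      p_convex_on_funpow_fdiff_mono[OF conv, of y] y by auto
  show ?thesis
  proof (cases "p = 0")
    case True
    have incr: "g u \<le> g (u + s)" if "a \<le> u" "s \<ge> 0" for u s
      using newton_remainder_gbinomial_nonneg[OF conv, of u s] that True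
      by (cases "s = 0") (auto simp: newton_remainder_def zero_le_mult_iff)
    show ?thesis
      using incr[of y t] incr[of "y + t" "1 - t"] t y mono True
      by (auto simp: newton_remainder_def)
  next
    case False
    show ?thesis
    proof (cases "t = 0 \<or> t = 1")
      case True
      then have "?R = 0"
        using False newton_remainder_at_nat[of 0 "Suc p" g y] newton_remainder_at_nat[of 1 "Suc p" g y]
        by auto
      then show ?thesis using mono by simp
    next
      case nontriv: False
      define c where "c = t gchoose p"
      define d where "d = ?E y - ?E (y - 1)"
      have "0 \<le> ?R * (t gchoose Suc p)"
        using newton_remainder_gbinomial_nonneg[OF conv, of y t] nontriv t y by auto
      also have "(t gchoose Suc p) = c * ((t - real p) / real (Suc p))"
        using gbinomial_mult_1[of t p] by (simp add: field_simps c_def)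
      finally have "0 \<le> ?R * c * (t - real p)"
        by (simp add: zero_le_divide_iff mult.assoc)
      then have R_c: "?R * c \<le> 0"
        using nontriv t False by (auto simp: zero_le_mult_iff)
      have "0 \<le> newton_remainder g (Suc p) (y - 1) (t + 1) * ((t + 1) gchoose Suc p)"
        using newton_remainder_gbinomial_nonneg[OF conv, of "y - 1" "t + 1"] t y by auto
      also have "((t + 1) gchoose Suc p) = c * ((t + 1) / real (Suc p))"
        using gbinomial_absorption[of p "t + 1"] by (simp add: field_simps c_def)
      also have "newton_remainder g (Suc p) (y - 1) (t + 1) = ?R + c * d"
        using newton_remainder_add_one[of g p "y - 1" t] by (simp add: c_def d_def)
      finally have "0 \<le> (?R + c * d) * c * (t + 1)"
        by (simp add: zero_le_divide_iff mult.assoc)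
      then have R_cd: "0 \<le> (?R + c * d) * c"
        using t by (auto simp: zero_le_mult_iff)
      have "\<bar>?R\<bar> \<le> \<bar>c\<bar> * d"
      proof (cases "c = 0")
        case True
        have "t \<noteq> real i" for i
        proof
          assume "t = real i"
          then have "i = 0 \<or> i = 1" using t by auto
          then show False using nontriv \<open>t = real i\<close> by auto
        qed
        then have "c \<noteq> 0"
          by (auto simp: c_def gbinomial_prod_rev)
        with True show ?thesis by simp
      next
        case False
        then consider "c > 0" | "c < 0" by linarith
        then show ?thesis
        proof cases
          case 1
          then have "?R \<le> 0" "0 \<le> ?R + c * d"
            using R_c R_cd by (auto simp: zero_le_mult_iff mult_le_0_iff)
          then show ?thesis using 1 by simp
        next
          case 2
          then have "?R \<ge> 0" "0 \<ge> ?R + c * d"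
            using R_c R_cd by (auto simp: zero_le_mult_iff mult_le_0_iff)
          then show ?thesis using 2 by simp
        qed
      qed
      also have "\<dots> \<le> 1 * d"
        using abs_gbinomial_le_1[OF t, of p] mono by (intro mult_right_mono) (auto simp: c_def d_def)
      finally show ?thesis
        using mono by (simp add: d_def)
    qed
  qed
qed

lemma divided_difference_cmult:
  "divided_difference (\<lambda>x. c * f x) x n = c * divided_difference f x n"
  by (simp add: divided_difference_def sum_distrib_left)

lemma K_class_iff_sign:
  "g \<in> K_class p \<longleftrightarrow> (\<exists>a>0. \<exists>c\<in>{1, - 1}. p_convex_on p {a..} (\<lambda>x. c * g x))"
  using divided_difference_cmult[of "- 1" g]
  by (auto simp: K_class_def p_convex_on_def p_concave_on_def)

text \<open>The constant is \<open>1\<close> for convexity and \<open>- 1\<close> for concavity. A signed bound is kept,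
  instead of an absolute value, because it has to telescope when summed over unit steps.\<close>
lemma K_class_newton_remainder_bound:
  assumes "g \<in> K_class p"
  obtains c where
    "\<forall>\<^sub>F y in at_top. \<forall>t\<in>{0..1}. \<bar>newton_remainder g (Suc p) y t\<bar>
       \<le> c * ((fdiff ^^ p) g (y + 1) - (fdiff ^^ p) g (y - 1))"
proof -
  obtain a c where c: "c \<in> {1, - 1}" and conv: "p_convex_on p {a..} (\<lambda>x. c * g x)"
    using assms unfolding K_class_iff_sign by blast
  have abs_c: "\<bar>c\<bar> = 1" using c by auto
  show thesis
  proof
    show "\<forall>\<^sub>F y in at_top. \<forall>t\<in>{0..1}. \<bar>newton_remainder g (Suc p) y t\<bar>
       \<le> c * ((fdiff ^^ p) g (y + 1) - (fdiff ^^ p) g (y - 1))"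
    proof (rule eventually_mono[OF eventually_ge_at_top[of "a + 1"]], intro ballI)
      fix y t assume "a + 1 \<le> y" "t \<in> {0..1::real}"
      then show "\<bar>newton_remainder g (Suc p) y t\<bar> \<le> c * ((fdiff ^^ p) g (y + 1) - (fdiff ^^ p) g (y - 1))"
        using p_convex_on_newton_remainder_bound[OF conv] abs_c
        by (simp add: newton_remainder_cmult funpow_fdiff_cmult abs_mult right_diff_distrib)
    qed
  qed
qed

section \<open>High differences vanish at infinity\<close>

lemma tendsto_gbinomial_mult_0:
  fixes t d :: "'a \<Rightarrow> real"
  assumes "(d \<longlongrightarrow> 0) F" "\<And>y. t y \<in> {0..1}"
  shows "((\<lambda>y. (t y gchoose k) * d y) \<longlongrightarrow> 0) F"
proof (rule Lim_null_comparison)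
  show "\<forall>\<^sub>F y in F. norm ((t y gchoose k) * d y) \<le> \<bar>d y\<bar>"
    using abs_gbinomial_le_1[OF assms(2)] by (auto simp: abs_mult intro!: always_eventually mult_left_le_one_le)
  show "((\<lambda>y. \<bar>d y\<bar>) \<longlongrightarrow> 0) F"
    using assms(1) by (rule tendsto_rabs_zero)
qed

lemma filterlim_add_const_at_top: "filterlim (\<lambda>y::real. y + c) at_top at_top"
  by (subst add.commute) (rule filterlim_tendsto_add_at_top[OF tendsto_const filterlim_ident])

text \<open>The passage from integer to real arguments. Decompose \<open>y\<close> into integer and fractional part; the
  induction trades one order of the remainder for one difference of \<open>h\<close>, until the remainder is
  \<open>\<Delta>\<^sup>q h(y) - \<Delta>\<^sup>q h(\<lfloor>y\<rfloor>)\<close>.\<close>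
lemma funpow_fdiff_tendsto_0_of_floor:
  assumes "((\<lambda>y. newton_remainder h (Suc q) (of_int \<lfloor>y\<rfloor>) (frac y)) \<longlongrightarrow> 0) at_top"
    and "((\<lambda>y::real. (fdiff ^^ q) h (of_int \<lfloor>y\<rfloor>)) \<longlongrightarrow> 0) at_top"
  shows "((fdiff ^^ q) h \<longlongrightarrow> 0) at_top"
  using assms
proof (induction q arbitrary: h)
  case 0
  then have "((\<lambda>y. newton_remainder h (Suc 0) (of_int \<lfloor>y\<rfloor>) (frac y) + h (of_int \<lfloor>y\<rfloor>)) \<longlongrightarrow> 0 + 0) at_top"
    by (intro tendsto_add) simp_all
  then show ?case
    by (simp add: newton_remainder_def frac_def)
next
  case (Suc q)
  let ?R = "newton_remainder h (Suc (Suc q))" and ?E = "(fdiff ^^ Suc q) h"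
  have shift: "((\<lambda>y::real. f (of_int \<lfloor>y\<rfloor> + 1) (frac y)) \<longlongrightarrow> 0) at_top"
    if "((\<lambda>y. f (of_int \<lfloor>y\<rfloor>) (frac y)) \<longlongrightarrow> 0) at_top" for f :: "real \<Rightarrow> real \<Rightarrow> real"
    using filterlim_compose[OF that filterlim_add_const_at_top[of 1]]
    by (simp add: frac_def)
  have "((\<lambda>y. ?R (of_int \<lfloor>y\<rfloor> + 1) (frac y) - ?R (of_int \<lfloor>y\<rfloor>) (frac y)
      + (frac y gchoose Suc q) * (?E (of_int \<lfloor>y\<rfloor> + 1) - ?E (of_int \<lfloor>y\<rfloor>))) \<longlongrightarrow> 0 - 0 + 0) at_top"
  proof (intro tendsto_add tendsto_diff tendsto_gbinomial_mult_0)
    show "((\<lambda>y. ?R (of_int \<lfloor>y\<rfloor> + 1) (frac y)) \<longlongrightarrow> 0) at_top"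
      using shift[OF Suc.prems(1)] .
    show "((\<lambda>y::real. ?E (of_int \<lfloor>y\<rfloor> + 1) - ?E (of_int \<lfloor>y\<rfloor>)) \<longlongrightarrow> 0) at_top"
      using tendsto_diff[OF shift[of "\<lambda>y _. ?E y", OF Suc.prems(2)] Suc.prems(2)] by simp
    show "frac y \<in> {0..1}" for y :: real
      using frac_lt_1[of y] by (auto simp: less_imp_le)
  qed (use Suc.prems in simp)
  then have "((fdiff ^^ q) (fdiff h) \<longlongrightarrow> 0) at_top"
    using Suc.prems(2) by (intro Suc.IH) (simp_all only: newton_remainder_fdiff funpow_fdiff_fdiff, simp)
  then show ?case by (simp only: funpow_fdiff_fdiff)
qed

lemma funpow_fdiff_tendsto_0:
  assumes D: "g \<in> D_class p" and K: "g \<in> K_class p"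
  shows "((fdiff ^^ p) g \<longlongrightarrow> 0) at_top"
proof (rule funpow_fdiff_tendsto_0_of_floor)
  let ?E = "(fdiff ^^ p) g"
  obtain c where bound:
    "\<forall>\<^sub>F y in at_top. \<forall>t\<in>{0..1}. \<bar>newton_remainder g (Suc p) y t\<bar> \<le> c * (?E (y + 1) - ?E (y - 1))"
    using K_class_newton_remainder_bound[OF K] by blast
  have "((\<lambda>y::real. ?E (real (nat \<lfloor>y\<rfloor>))) \<longlongrightarrow> 0) at_top"
    using D unfolding D_class_def
    by (auto intro: filterlim_compose[OF _ filterlim_compose[OF filterlim_nat_sequentially filterlim_floor_sequentially]])
  moreover have "\<forall>\<^sub>F y::real in at_top. ?E (real (nat \<lfloor>y\<rfloor>)) = ?E (of_int \<lfloor>y\<rfloor>)"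
    using eventually_ge_at_top[of "0::real"] by (rule eventually_mono) simp
  ultimately show lim: "((\<lambda>y::real. ?E (of_int \<lfloor>y\<rfloor>)) \<longlongrightarrow> 0) at_top"
    by (rule Lim_transform_eventually)
  have shift: "((\<lambda>y::real. ?E (of_int \<lfloor>y\<rfloor> + of_int i)) \<longlongrightarrow> 0) at_top" for i :: int
    using filterlim_compose[OF lim filterlim_add_const_at_top[of "of_int i"]] by simp
  show "((\<lambda>y. newton_remainder g (Suc p) (of_int \<lfloor>y\<rfloor>) (frac y)) \<longlongrightarrow> 0) at_top"
  proof (rule Lim_null_comparison)
    show "\<forall>\<^sub>F y in at_top. norm (newton_remainder g (Suc p) (of_int \<lfloor>y\<rfloor>) (frac y))
        \<le> c * (?E (of_int \<lfloor>y\<rfloor> + 1) - ?E (of_int \<lfloor>y\<rfloor> - 1))"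
      using eventually_compose_filterlim[OF bound
          filterlim_compose[OF filterlim_real_of_int_at_top filterlim_floor_sequentially]]
    proof (rule eventually_mono)
      show "norm (newton_remainder g (Suc p) (of_int \<lfloor>y\<rfloor>) (frac y))
          \<le> c * (?E (of_int \<lfloor>y\<rfloor> + 1) - ?E (of_int \<lfloor>y\<rfloor> - 1))"
        if "\<forall>t\<in>{0..1}. \<bar>newton_remainder g (Suc p) (of_int \<lfloor>y\<rfloor>) t\<bar>
          \<le> c * (?E (of_int \<lfloor>y\<rfloor> + 1) - ?E (of_int \<lfloor>y\<rfloor> - 1))" for y :: real
        using that frac_lt_1[of y] by (simp add: less_imp_le)
    qed
    show "((\<lambda>y::real. c * (?E (of_int \<lfloor>y\<rfloor> + 1) - ?E (of_int \<lfloor>y\<rfloor> - 1))) \<longlongrightarrow> 0) at_top"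
      using tendsto_mult_right_zero[OF tendsto_diff[OF shift[of 1] shift[of "- 1"], simplified]] by simp
  qed
qed

lemma funpow_fdiff_tendsto_0_ge:
  assumes "((fdiff ^^ p) g \<longlongrightarrow> 0) at_top" "p \<le> j"
  shows "((fdiff ^^ j) g \<longlongrightarrow> 0) at_top"
  using assms(2)
proof (induction j rule: dec_induct)
  case (step j)
  have "((\<lambda>y. (fdiff ^^ j) g (y + 1) - (fdiff ^^ j) g y) \<longlongrightarrow> 0 - 0) at_top"
    by (intro tendsto_diff step.IH filterlim_compose[OF step.IH filterlim_add_const_at_top])
  then show ?case by (simp only: funpow_fdiff_Suc diff_0_right)
qed (rule assms(1))

section \<open>Binet functions as integrals of remainders\<close>

lemma has_integral_gregory: "((\<lambda>t. t gchoose n) has_integral gregory n) {0..1}"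
  unfolding gregory_def gbinomial_prod_rev
  by (intro integrable_integral integrable_continuous_real continuous_intros) simp

lemma has_integral_unit_shift:
  fixes f :: "real \<Rightarrow> real"
  assumes "f integrable_on {y..y+1}"
  shows "((\<lambda>t. f (y + t)) has_integral integral {y..y+1} f) {0..1}"
  using has_integral_shift_cbox_iff[of f y "integral {y..y+1} f" 0 1] integrable_integral[OF assms]
  by (simp add: o_def add.commute)

lemma has_integral_newton_remainder:
  assumes "f integrable_on {y..y+1}"
  shows "((\<lambda>t. newton_remainder f k y t) has_integral - gen_binet k f y) {0..1}"
proof -
  have "((\<lambda>t. newton_remainder f k y t) has_integral
    (integral {y..y+1} f - (\<Sum>j<k. gregory j * (fdiff ^^ j) f y))) {0..1}"
    unfolding newton_remainder_def
    by (intro has_integral_diff has_integral_unit_shift[OF assms] has_integral_sum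
        has_integral_mult_left has_integral_gregory) simp
  then show ?thesis by (simp add: gen_binet_def)
qed

lemma gen_binet_tendsto_0:
  assumes "\<forall>\<^sub>F y in at_top. f integrable_on {y..y+1}"
    and "\<forall>\<^sub>F y in at_top. \<forall>t\<in>{0..1}. \<bar>newton_remainder f k y t\<bar> \<le> B y"
    and "(B \<longlongrightarrow> 0) at_top"
  shows "(gen_binet k f \<longlongrightarrow> 0) at_top"
proof (rule Lim_null_comparison[OF _ assms(3)])
  show "\<forall>\<^sub>F y in at_top. norm (gen_binet k f y) \<le> B y"
    using assms(1,2)
  proof eventually_elim
    case (elim y)
    have "0 \<le> B y" using elim(2) by force
    then show ?case
      using has_integral_bound_real[OF _ finite.emptyI has_integral_newton_remainder[OF elim(1), of k], of "B y"] elim(2)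
      by simp
  qed
qed

lemma gen_binet_Suc: "gen_binet (Suc k) f x = gen_binet k f x + gregory k * (fdiff ^^ k) f x"
  by (simp add: gen_binet_def)

lemma K_class_gen_binet_tendsto_0:
  assumes K: "f \<in> K_class p"
    and int: "\<forall>\<^sub>F y in at_top. f integrable_on {y..y+1}"
    and lim: "((\<lambda>y. (fdiff ^^ p) f (y + 1) - (fdiff ^^ p) f (y - 1)) \<longlongrightarrow> 0) at_top"
  shows "(gen_binet (Suc p) f \<longlongrightarrow> 0) at_top"
proof -
  obtain c where bound:
    "\<forall>\<^sub>F y in at_top. \<forall>t\<in>{0..1}. \<bar>newton_remainder f (Suc p) y t\<bar>
       \<le> c * ((fdiff ^^ p) f (y + 1) - (fdiff ^^ p) f (y - 1))"
    using K_class_newton_remainder_bound[OF K] by blast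
  then show ?thesis
    using tendsto_mult_right_zero[OF lim] by (rule gen_binet_tendsto_0[OF int])
qed

text \<open>The order of a Binet function is immaterial in the limit beyond the order from which differences
  vanish at infinity; this is how statements for different admissible orders are compared.\<close>
lemma gen_binet_tendsto_0_iff:
  assumes "\<And>j. k \<le> j \<Longrightarrow> ((fdiff ^^ j) f \<longlongrightarrow> 0) at_top" "k \<le> l"
  shows "(gen_binet l f \<longlongrightarrow> 0) at_top \<longleftrightarrow> (gen_binet k f \<longlongrightarrow> 0) at_top"
  using assms(2)
proof (induction l rule: dec_induct)
  case (step l)
  have 0: "((\<lambda>x. gregory l * (fdiff ^^ l) f x) \<longlongrightarrow> 0) at_top"
    using assms(1)[OF step.hyps(1)] by (rule tendsto_mult_right_zero)
  have "(gen_binet (Suc l) f \<longlongrightarrow> 0) at_top \<longleftrightarrow> (gen_binet l f \<longlongrightarrow> 0) at_top"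
    using tendsto_add[OF _ 0, of "gen_binet l f" 0] tendsto_diff[OF _ 0, of "gen_binet (Suc l) f" 0]
    by (auto simp: gen_binet_Suc[abs_def])
  then show ?case using step.IH by simp
qed simp

section \<open>Existence of the indefinite sum\<close>

lemma indef_sum_seq_altdef:
  assumes "n \<ge> 1"
  shows "indef_sum_seq p g x n = (\<Sum>k=1..<n. g (real k)) - (\<Sum>k<n. g (x + real k))
     + (\<Sum>j<p. (x gchoose Suc j) * (fdiff ^^ j) g (real n))"
proof -
  have "(\<Sum>k<n. g (x + real k)) = g x + (\<Sum>k=1..<n. g (x + real k))"
    using assms by (simp add: sum.atLeast_Suc_lessThan flip: atLeast0LessThan)
  then show ?thesis
    by (simp add: indef_sum_seq_def sum_subtractf sum.atLeast1_atMost_eq)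
qed

lemma indef_sum_seq_Suc:
  assumes "n \<ge> 1"
  shows "indef_sum_seq p g x (Suc n) - indef_sum_seq p g x n = - newton_remainder g (Suc p) (real n) x"
proof -
  have "(\<Sum>j<p. (x gchoose Suc j) * (fdiff ^^ j) g (real n + 1)) - (\<Sum>j<p. (x gchoose Suc j) * (fdiff ^^ j) g (real n))
    = (\<Sum>j<p. (x gchoose Suc j) * (fdiff ^^ Suc j) g (real n))"
    unfolding funpow_fdiff_Suc by (simp add: right_diff_distrib sum_subtractf)
  then show ?thesis
    using assms unfolding newton_remainder_def sum.lessThan_Suc_shift
    by (simp add: indef_sum_seq_altdef add_ac)
qed

text \<open>The approximants satisfy the difference equation up to a remainder. This yields \<open>\<Delta>(\<Sigma>g) = g\<close> and
  also carries convergence from the interval \<open>(0, 1]\<close> to all positive arguments.\<close>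
lemma indef_sum_seq_add_one:
  assumes "n \<ge> 1"
  shows "indef_sum_seq p g (x + 1) n = indef_sum_seq p g x n + g x - newton_remainder g p (real n) x"
proof -
  have "(\<Sum>k<n. g (x + 1 + real k)) = (\<Sum>k<n. g (x + real k)) + g (x + real n) - g x"
    using sum.lessThan_Suc_shift[of "\<lambda>k. g (x + real k)" n] by (simp add: add_ac)
  then show ?thesis
    unfolding newton_remainder_def indef_sum_seq_altdef[OF assms] gbinomial_Suc_Suc
    by (simp add: distrib_right sum.distrib add.commute)
qed

text \<open>On \<open>[0, 1]\<close> this is the remainder estimate; changing the base extends it to larger \<open>x\<close> one unit
  at a time, at the cost of a multiple of \<open>\<Delta>\<^sup>p g(y + 1) - \<Delta>\<^sup>p g(y)\<close>.\<close>
lemma newton_remainder_tendsto_0: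
  assumes D: "g \<in> D_class p" and K: "g \<in> K_class p" and x: "x > 0"
  shows "((\<lambda>y. newton_remainder g (Suc p) y x) \<longlongrightarrow> 0) at_top"
proof -
  let ?E = "(fdiff ^^ p) g"
  have E: "((\<lambda>y. ?E (y + i)) \<longlongrightarrow> 0) at_top" for i
    by (rule filterlim_compose[OF funpow_fdiff_tendsto_0[OF D K] filterlim_add_const_at_top])
  have unit: "((\<lambda>y. newton_remainder g (Suc p) y t) \<longlongrightarrow> 0) at_top" if t: "t \<in> {0..1}" for t
  proof -
    obtain c where bound: "\<forall>\<^sub>F y in at_top. \<forall>t\<in>{0..1}.
        \<bar>newton_remainder g (Suc p) y t\<bar> \<le> c * (?E (y + 1) - ?E (y - 1))"
      using K_class_newton_remainder_bound[OF K] by blast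
    show ?thesis
    proof (rule Lim_null_comparison)
      show "\<forall>\<^sub>F y in at_top. norm (newton_remainder g (Suc p) y t) \<le> c * (?E (y + 1) - ?E (y - 1))"
        using bound by (rule eventually_mono) (use t in simp)
      show "((\<lambda>y. c * (?E (y + 1) - ?E (y - 1))) \<longlongrightarrow> 0) at_top"
        using tendsto_mult_right_zero[OF tendsto_diff[OF E[of 1] E[of "- 1"], simplified]] by simp
    qed
  qed
  have "((\<lambda>y. newton_remainder g (Suc p) y (t + real m)) \<longlongrightarrow> 0) at_top" if "t \<in> {0..1}" for t m
  proof (induction m)
    case (Suc m)
    have "((\<lambda>y. newton_remainder g (Suc p) (y + 1) (t + real m)
        + ((t + real m) gchoose p) * (?E (y + 1) - ?E (y + 0))) \<longlongrightarrow> 0 + 0) at_top"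
      by (intro tendsto_add filterlim_compose[OF Suc filterlim_add_const_at_top] tendsto_mult_right_zero)
        (use tendsto_diff[OF E[of 1] E[of 0]] in simp)
    moreover have eq: "t + real (Suc m) = (t + real m) + 1" by simp
    ultimately show ?case
      unfolding eq newton_remainder_add_one by simp
  qed (use unit that in simp)
  from this[of "frac x" "nat \<lfloor>x\<rfloor>"] show ?thesis
    using x frac_lt_1[of x] by (simp add: less_imp_le frac_def)
qed

lemma newton_remainder_real_tendsto_0:
  assumes D: "g \<in> D_class p" and K: "g \<in> K_class p" and x: "x > 0"
  shows "(\<lambda>n. newton_remainder g p (real n) x) \<longlonglongrightarrow> 0"
proof -
  have "((\<lambda>y. newton_remainder g (Suc p) y x + (x gchoose p) * (fdiff ^^ p) g y) \<longlongrightarrow> 0 + 0) at_top"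
    by (intro tendsto_add newton_remainder_tendsto_0 D K x tendsto_mult_right_zero funpow_fdiff_tendsto_0)
  then have "((\<lambda>y. newton_remainder g p y x) \<longlongrightarrow> 0) at_top"
    by (simp add: newton_remainder_Suc)
  then show ?thesis
    by (rule filterlim_compose[OF _ filterlim_real_sequentially])
qed

text \<open>For \<open>x\<close> in \<open>(0, 1]\<close> the increments are remainders, and their bound
  \<open>\<Delta>\<^sup>p g(n + 1) - \<Delta>\<^sup>p g(n - 1)\<close> is itself the increment of the null sequence
  \<open>\<Delta>\<^sup>p g(n) + \<Delta>\<^sup>p g(n - 1)\<close>, hence summable.\<close>
lemma indef_sum_seq_convergent:
  assumes D: "g \<in> D_class p" and K: "g \<in> K_class p" and x: "x > 0"
  shows "convergent (indef_sum_seq p g x)"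
proof -
  let ?E = "(fdiff ^^ p) g"
  have E_lim: "((\<lambda>y. ?E (y + i)) \<longlongrightarrow> 0) at_top" for i
    by (rule filterlim_compose[OF funpow_fdiff_tendsto_0[OF D K] filterlim_add_const_at_top])
  have E: "(\<lambda>n. ?E (real n + i)) \<longlonglongrightarrow> 0" for i
    by (rule filterlim_compose[OF E_lim filterlim_real_sequentially])
  have unit: "convergent (indef_sum_seq p g t)" if t: "t \<in> {0..1}" for t
  proof -
    obtain c where bound: "\<forall>\<^sub>F y in at_top. \<forall>t\<in>{0..1}.
        \<bar>newton_remainder g (Suc p) y t\<bar> \<le> c * (?E (y + 1) - ?E (y - 1))"
      using K_class_newton_remainder_bound[OF K] by blast
    define F where "F n = c * (?E (real n) + ?E (real n - 1))" for n
    have "F \<longlonglongrightarrow> 0"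
      unfolding F_def using tendsto_mult_right_zero[OF tendsto_add[OF E[of 0] E[of "- 1"], simplified]] by simp
    then have "summable (\<lambda>n. F (Suc n) - F n)"
      by (rule telescope_summable)
    then have "summable (\<lambda>n. indef_sum_seq p g t (Suc n) - indef_sum_seq p g t n)"
    proof (rule summable_comparison_test_ev[rotated])
      show "\<forall>\<^sub>F n in sequentially.
          norm (indef_sum_seq p g t (Suc n) - indef_sum_seq p g t n) \<le> F (Suc n) - F n"
        using eventually_compose_filterlim[OF bound filterlim_real_sequentially] eventually_ge_at_top[of 1]
      proof eventually_elim
        case (elim n)
        then show ?case
          using bspec[OF elim(1) t] by (simp add: indef_sum_seq_Suc F_def algebra_simps)
      qed
    qed
    then have "convergent (\<lambda>n. \<Sum>k<n. indef_sum_seq p g t (Suc k) - indef_sum_seq p g t k)"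
      by (simp only: summable_iff_convergent)
    then have "convergent (\<lambda>n. indef_sum_seq p g t n - indef_sum_seq p g t 0)"
      by (simp only: sum_lessThan_telescope)
    then show ?thesis
      using convergent_add[OF _ convergent_const[of "indef_sum_seq p g t 0"]] by fastforce
  qed
  have step: "convergent (indef_sum_seq p g (y + 1))" if "convergent (indef_sum_seq p g y)" "y > 0" for y
  proof -
    have "convergent (\<lambda>n. indef_sum_seq p g y n + g y - newton_remainder g p (real n) y)"
      by (intro convergent_diff convergent_add convergent_const that(1) convergentI[OF newton_remainder_real_tendsto_0[OF D K that(2)]])
    moreover have "\<forall>\<^sub>F n in sequentially. indef_sum_seq p g y n + g y - newton_remainder g p (real n) y
        = indef_sum_seq p g (y + 1) n"
      using eventually_ge_at_top[of 1] by (rule eventually_mono) (simp add: indef_sum_seq_add_one)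
    ultimately show ?thesis
      by (subst (asm) convergent_cong) auto
  qed
  have pos: "convergent (indef_sum_seq p g (t + real m))" if "t \<in> {0<..1}" for t m
  proof (induction m)
    case (Suc m)
    then show ?case using step[of "t + real m"] that by (simp add: add_ac)
  qed (use unit that in simp)
  define m where "m = nat (\<lceil>x\<rceil> - 1)"
  have "real m = of_int \<lceil>x\<rceil> - 1" using x by (simp add: m_def)
  then have "x - real m \<in> {0<..1}" by simp linarith
  from pos[OF this, of m] show ?thesis by simp
qed

section \<open>Regularity of the indefinite sum\<close>

lemma funpow_fdiff_cong:
  assumes "\<And>x. x > 0 \<Longrightarrow> f x = h x" "x > 0"
  shows "(fdiff ^^ j) f x = (fdiff ^^ j) h x"
  using assms(2)
proof (induction j arbitrary: x)
  case (Suc j)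
  then show ?case by (simp add: fdiff_def)
qed (use assms(1) in simp)

lemma funpow_fdiff_antidifference:
  assumes S: "\<And>x. x > 0 \<Longrightarrow> S (x + 1) = S x + g x" and x: "x > 0"
  shows "(fdiff ^^ Suc j) S x = (fdiff ^^ j) g x"
  using funpow_fdiff_cong[of "fdiff S" g x j] S x
  by (simp only: funpow_fdiff_fdiff) (simp add: fdiff_def)

lemma indef_sum_limit_add_one:
  assumes D: "g \<in> D_class p" and K: "g \<in> K_class p"
    and lim: "\<And>x. x > 0 \<Longrightarrow> indef_sum_seq p g x \<longlonglongrightarrow> S x" and x: "x > 0"
  shows "S (x + 1) = S x + g x"
proof -
  have "(\<lambda>n. indef_sum_seq p g x n + g x - newton_remainder g p (real n) x) \<longlonglongrightarrow> S x + g x - 0"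
    by (intro tendsto_diff tendsto_add lim x tendsto_const newton_remainder_real_tendsto_0 D K)
  moreover have "\<forall>\<^sub>F n in sequentially. indef_sum_seq p g x n + g x - newton_remainder g p (real n) x
      = indef_sum_seq p g (x + 1) n"
    using eventually_ge_at_top[of 1] by (rule eventually_mono) (simp add: indef_sum_seq_add_one)
  ultimately have "indef_sum_seq p g (x + 1) \<longlonglongrightarrow> S x + g x - 0"
    by (rule Lim_transform_eventually)
  moreover have "indef_sum_seq p g (x + 1) \<longlonglongrightarrow> S (x + 1)"
    using x by (intro lim) simp
  ultimately show ?thesis
    using LIMSEQ_unique by fastforce
qed

text \<open>As a function of its argument, an approximant is a polynomial of degree at most \<open>p\<close> minus
  translates of \<open>g\<close>, and the divided difference does not see the polynomial.\<close>
lemma divided_difference_indef_sum_seq: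
  assumes x: "strict_mono_on {..p + 1} x" and n: "n \<ge> 1"
  shows "divided_difference (\<lambda>y. indef_sum_seq p g y n) x (p + 1) =
    - (\<Sum>k<n. divided_difference g (\<lambda>i. x i + real k) (p + 1))"
proof -
  \<comment> \<open>The summand for \<open>j = 0\<close> absorbs the sum of the values of \<open>g\<close> at integers, a constant in \<open>y\<close>.\<close>
  obtain q :: "real poly" where q: "degree q \<le> p"
    "\<And>y. poly q y = (\<Sum>j\<le>p. ((y - 0) gchoose j) *
        (case j of 0 \<Rightarrow> \<Sum>k=1..<n. g (real k) | Suc i \<Rightarrow> (fdiff ^^ i) g (real n)))"
    using gbinomial_sum_shift_poly by blast
  have seq: "indef_sum_seq p g y n = poly q y - (\<Sum>k<n. g (y + real k))" for y
    unfolding q(2) indef_sum_seq_altdef[OF n] sum.atMost_shift by simp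
  have inj: "inj_on x {..p + 1}"
    using x by (rule strict_mono_on_imp_inj_on)
  have "divided_difference (poly q) x (p + 1) = 0"
    unfolding divided_difference_eq_set[OF inj]
    by (rule set_divided_difference_poly_eq_0) (use q(1) inj in \<open>simp_all add: card_image\<close>)
  moreover have "divided_difference (\<lambda>y. indef_sum_seq p g y n) x (p + 1)
    = divided_difference (poly q) x (p + 1) - (\<Sum>k<n. divided_difference g (\<lambda>i. x i + real k) (p + 1))"
    unfolding divided_difference_def seq
    by (subst sum.swap) (simp add: diff_divide_distrib sum_subtractf sum_divide_distrib)
  ultimately show ?thesis by simp
qed

text \<open>The indefinite sum of a \<open>p\<close>-convex function is \<open>p\<close>-concave and vice versa: the sign of the divided
  differences of \<open>- g\<close> survives summation over translates and the pointwise limit.\<close>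
lemma indef_sum_limit_K_class:
  assumes K: "g \<in> K_class p"
    and lim: "\<And>x. x > 0 \<Longrightarrow> indef_sum_seq p g x \<longlonglongrightarrow> S x"
  shows "S \<in> K_class p"
proof -
  obtain a c where a: "a > 0" and c: "c \<in> {1, - 1}" and conv: "p_convex_on p {a..} (\<lambda>x. c * g x)"
    using K unfolding K_class_iff_sign by blast
  have "p_convex_on p {a..} (\<lambda>x. - c * S x)"
    unfolding p_convex_on_def
  proof (intro allI impI, elim conjE)
    fix x assume x: "strict_mono_on {..p + 1} x" "x ` {..p + 1} \<subseteq> {a..}"
    have nonneg: "0 \<le> c * divided_difference g (\<lambda>i. x i + real k) (p + 1)" for k
    proof -
      have "strict_mono_on {..p + 1} (\<lambda>i. x i + real k)"
        using x(1) by (simp add: strict_mono_on_def)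
      moreover have "(\<lambda>i. x i + real k) ` {..p + 1} \<subseteq> {a..}"
        using x(2) by (force simp: image_subset_iff)
      ultimately show ?thesis
        using conv divided_difference_cmult[of c g] unfolding p_convex_on_def by metis
    qed
    have "(\<lambda>n. - c * divided_difference (\<lambda>y. indef_sum_seq p g y n) x (p + 1))
        \<longlonglongrightarrow> - c * divided_difference S x (p + 1)"
      unfolding divided_difference_def
    proof (intro tendsto_mult_left tendsto_sum tendsto_divide tendsto_const)
      fix k assume "k \<in> {..p + 1}"
      then have "x k > 0" using x(2) a by (force simp: image_subset_iff)
      then show "indef_sum_seq p g (x k) \<longlonglongrightarrow> S (x k)" by (rule lim)
      show "(\<Prod>j\<in>{..p + 1} - {k}. x k - x j) \<noteq> 0"
        using strict_mono_on_imp_inj_on[OF x(1)] \<open>k \<in> {..p + 1}\<close> by (auto simp: inj_on_def)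
    qed
    moreover have "\<forall>\<^sub>F n in sequentially. 0 \<le> - c * divided_difference (\<lambda>y. indef_sum_seq p g y n) x (p + 1)"
      using eventually_ge_at_top[of 1]
    proof (rule eventually_mono)
      fix n :: nat assume n: "1 \<le> n"
      show "0 \<le> - c * divided_difference (\<lambda>y. indef_sum_seq p g y n) x (p + 1)"
        unfolding divided_difference_indef_sum_seq[OF x(1) n]
        using sum_nonneg[of "{..<n}", OF nonneg] by (simp flip: sum_distrib_left)
    qed
    ultimately have "0 \<le> - c * divided_difference S x (p + 1)"
      by (intro tendsto_lowerbound) auto
    then show "0 \<le> divided_difference (\<lambda>x. - c * S x) x (p + 1)"
      by (simp only: divided_difference_cmult)
  qed
  moreover have "- c \<in> {1, - 1}" using c by auto
  ultimately show ?thesis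
    using a unfolding K_class_iff_sign by blast
qed

text \<open>Far to the right \<open>S\<close> is uniformly close to its Newton polynomial on a unit interval, and the
  difference equation transports this back to \<open>[x, x + 1]\<close> by subtracting finitely many translates of
  \<open>g\<close>. So \<open>S\<close> is a uniform limit of continuous functions there.\<close>
lemma continuous_on_unit_interval_of_fdiff:
  assumes K: "S \<in> K_class p" and cont: "continuous_on {0<..} g"
    and S: "\<And>x. x > 0 \<Longrightarrow> S (x + 1) = S x + g x"
    and lim: "((\<lambda>y. (fdiff ^^ p) S (y + 1) - (fdiff ^^ p) S (y - 1)) \<longlongrightarrow> 0) at_top"
    and x: "x > 0"
  shows "continuous_on {0..1} (\<lambda>t. S (x + t))"
proof -
  obtain c where bound: "\<forall>\<^sub>F y in at_top. \<forall>t\<in>{0..1}. \<bar>newton_remainder S (Suc p) y t\<bar>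
      \<le> c * ((fdiff ^^ p) S (y + 1) - (fdiff ^^ p) S (y - 1))" (is "\<forall>\<^sub>F y in _. \<forall>t\<in>_. _ \<le> ?B y")
    using K_class_newton_remainder_bound[OF K] by blast
  have at_top: "filterlim (\<lambda>n. x + real n) at_top sequentially"
    by (rule filterlim_tendsto_add_at_top[OF tendsto_const filterlim_real_sequentially])
  have shift: "S (y + real n) = S y + (\<Sum>k<n. g (y + real k))" if "y > 0" for y n
  proof (induction n)
    case (Suc n)
    then show ?case using S[of "y + real n"] that by (simp add: add_ac)
  qed simp
  define h where "h n t = S (x + real n + t) - newton_remainder S (Suc p) (x + real n) t
    - (\<Sum>k<n. g (x + t + real k))" for n t
  have "continuous_on {0..1} (h n)" for n
  proof -
    have "continuous_on {0..1} (\<lambda>t. (\<Sum>j<Suc p. (t gchoose j) * (fdiff ^^ j) S (x + real n))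
        - (\<Sum>k<n. g (x + t + real k)))"
      unfolding gbinomial_prod_rev
      by (intro continuous_intros continuous_on_compose2[OF cont]) (use x in auto)
    then show ?thesis
      by (simp add: h_def[abs_def] newton_remainder_def)
  qed
  moreover have "uniform_limit {0..1} h (\<lambda>t. S (x + t)) sequentially"
  proof (rule uniform_limitI)
    fix e :: real assume "e > 0"
    have "(\<lambda>n. ?B (x + real n)) \<longlonglongrightarrow> 0"
      by (rule filterlim_compose[OF tendsto_mult_right_zero[OF lim] at_top])
    then have "\<forall>\<^sub>F n in sequentially. ?B (x + real n) < e"
      using \<open>e > 0\<close> by (rule order_tendstoD)
    moreover have "\<forall>\<^sub>F n in sequentially. \<forall>t\<in>{0..1}.
        \<bar>newton_remainder S (Suc p) (x + real n) t\<bar> \<le> ?B (x + real n)"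
      by (rule eventually_compose_filterlim[OF bound at_top])
    ultimately show "\<forall>\<^sub>F n in sequentially. \<forall>t\<in>{0..1}. dist (h n t) (S (x + t)) < e"
    proof eventually_elim
      case (elim n)
      show ?case
      proof
        fix t :: real assume t: "t \<in> {0..1}"
        have "h n t - S (x + t) = - newton_remainder S (Suc p) (x + real n) t"
          using shift[of "x + t" n] x t by (simp add: h_def add_ac)
        then show "dist (h n t) (S (x + t)) < e"
          using elim t by (force simp: dist_real_def)
      qed
    qed
  qed
  ultimately show ?thesis
    by (intro uniform_limit_theorem[OF always_eventually]) auto
qed

lemma continuous_on_of_unit_intervals:
  fixes S :: "real \<Rightarrow> real"
  assumes "\<And>x. x > 0 \<Longrightarrow> continuous_on {0..1} (\<lambda>t. S (x + t))"
  shows "continuous_on {0<..} S"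
proof -
  have "isCont S z" if z: "z > 0" for z
  proof -
    define x where "x = max (z / 2) (z - 1 / 2)"
    have x: "x > 0" "x < z" "z < x + 1" using z by (auto simp: x_def max_def)
    have "continuous_on {x..x + 1} (\<lambda>y. S (x + (y - x)))"
      by (intro continuous_on_compose2[OF assms[OF x(1)]] continuous_intros) auto
    then have "continuous_on {x..x + 1} S" by simp
    then show ?thesis
      by (rule continuous_on_interior) (use x in simp)
  qed
  then show ?thesis
    by (auto intro: continuous_at_imp_continuous_on)
qed

text \<open>The derivative in \<open>x\<close> of the left-hand side is \<open>S(x + 1) - S(x) = g(x)\<close>, and both sides agree at
  \<open>x = 1\<close>; the proof replaces differentiation by splitting the interval \<open>[1, x + 1]\<close> in two ways.\<close>
lemma integral_unit_interval_of_fdiff: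
  fixes S :: "real \<Rightarrow> real"
  assumes contS: "continuous_on {0<..} S" and contg: "continuous_on {0<..} g"
    and S: "\<And>x. x > 0 \<Longrightarrow> S (x + 1) = S x + g x"
    and x: "x \<ge> 1"
  shows "integral {x..x+1} S = integral {0..1} (\<lambda>t. S (t + 1)) + integral {1..x} g"
proof -
  have int: "f integrable_on {a..b}" if "continuous_on {0<..} f" "a > 0" for f :: "real \<Rightarrow> real" and a b
    by (rule integrable_continuous_real[OF continuous_on_subset[OF that(1)]]) (use that(2) in auto)
  have "((\<lambda>t. S (1 + t)) has_integral integral {2..x+1} S) {1..x}"
    using has_integral_shift_cbox_iff[of S 1 "integral {2..x+1} S" 1 x]
      integrable_integral[OF int[OF contS, of 2 "x + 1"]] by (simp add: o_def)
  then have "integral {2..x+1} S = integral {1..x} (\<lambda>t. S (1 + t))"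
    by (simp add: integral_unique)
  also have "\<dots> = integral {1..x} (\<lambda>t. S t + g t)"
    by (rule integral_cong) (use S in \<open>simp add: add.commute\<close>)
  also have "\<dots> = integral {1..x} S + integral {1..x} g"
    by (intro Henstock_Kurzweil_Integration.integral_add int contS contg) auto
  finally have 1: "integral {2..x+1} S = integral {1..x} S + integral {1..x} g" .
  have 2: "integral {0..1} (\<lambda>t. S (t + 1)) = integral {1..2} S"
    using has_integral_unit_shift[OF int[OF contS, of 1 "1 + 1"]]
    by (simp add: integral_unique add.commute)
  have 3: "integral {1..2} S + integral {2..x+1} S = integral {1..x+1} S"
    by (rule Henstock_Kurzweil_Integration.integral_combine) (use x int[OF contS, of 1] in auto)
  have 4: "integral {1..x} S + integral {x..x+1} S = integral {1..x+1} S"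
    by (rule Henstock_Kurzweil_Integration.integral_combine) (use x int[OF contS, of 1] in auto)
  show ?thesis using 1 2 3 4 by simp
qed

section \<open>Asymptotics of the indefinite sum\<close>

text \<open>The remainder estimate for \<open>S\<close>, used with the order \<open>p\<close> of \<open>g\<close>: the bound
  \<open>\<Delta>\<^sup>p S(y + 1) - \<Delta>\<^sup>p S(y - 1)\<close> equals \<open>\<Delta>\<^sup>p g(y) + \<Delta>\<^sup>p g(y - 1)\<close>.\<close>
lemma indef_sum_gen_binet_tendsto_0:
  assumes cont: "continuous_on {0<..} g" and D: "g \<in> D_class p" and K: "g \<in> K_class p"
    and lim: "\<And>x. x > 0 \<Longrightarrow> indef_sum_seq p g x \<longlonglongrightarrow> S x"
  shows "continuous_on {0<..} S" "(gen_binet (Suc p) S \<longlongrightarrow> 0) at_top"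
proof -
  have KS: "S \<in> K_class p"
    by (rule indef_sum_limit_K_class[OF K lim])
  have S: "S (x + 1) = S x + g x" if "x > 0" for x
    by (rule indef_sum_limit_add_one[OF D K lim that])
  have "((\<lambda>y. (fdiff ^^ p) g y + (fdiff ^^ p) g (y + - 1)) \<longlongrightarrow> 0 + 0) at_top"
    by (intro tendsto_add filterlim_compose[OF _ filterlim_add_const_at_top] funpow_fdiff_tendsto_0 D K)
  moreover have "\<forall>\<^sub>F y in at_top. (fdiff ^^ p) g y + (fdiff ^^ p) g (y + - 1)
      = (fdiff ^^ p) S (y + 1) - (fdiff ^^ p) S (y - 1)"
  proof (rule eventually_mono[OF eventually_gt_at_top[of 1]])
    fix y :: real assume "y > 1"
    have "(fdiff ^^ p) g z = (fdiff ^^ p) S (z + 1) - (fdiff ^^ p) S z" if "z > 0" for z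
      using funpow_fdiff_antidifference[of S g z p] S that by (simp only: funpow_fdiff_Suc)
    from this[of y] this[of "y - 1"] show "(fdiff ^^ p) g y + (fdiff ^^ p) g (y + - 1)
      = (fdiff ^^ p) S (y + 1) - (fdiff ^^ p) S (y - 1)"
      using \<open>y > 1\<close> by simp
  qed
  ultimately have diff: "((\<lambda>y. (fdiff ^^ p) S (y + 1) - (fdiff ^^ p) S (y - 1)) \<longlongrightarrow> 0) at_top"
    using Lim_transform_eventually by force
  show contS: "continuous_on {0<..} S"
    by (intro continuous_on_of_unit_intervals continuous_on_unit_interval_of_fdiff[OF KS cont S diff])
  have "\<forall>\<^sub>F y in at_top. S integrable_on {y..y+1}"
    by (rule eventually_mono[OF eventually_gt_at_top[of 0]])
      (auto intro!: integrable_continuous_real continuous_on_subset[OF contS])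
  then show "(gen_binet (Suc p) S \<longlongrightarrow> 0) at_top"
    by (rule K_class_gen_binet_tendsto_0[OF KS _ diff])
qed

theorem theorem6p13:
  fixes g :: "real \<Rightarrow> real" and p :: nat
  assumes "continuous_on {0<..} g"
    and "g \<in> D_class p \<inter> K_class p"
  shows "(gen_binet (p + 1) (indef_sum g) \<longlongrightarrow> 0) at_top \<and>
    (gen_binet p g \<longlongrightarrow> 0) at_top \<and>
    ((\<lambda>x. indef_sum g x - integral {1..x} g
         + (\<Sum>j=1..p. gregory j * (fdiff ^^ (j - 1)) g x))
       \<longlongrightarrow> asymptotic_constant g) at_top \<and>
    ((\<lambda>x. integral {x..x+1} g - (\<Sum>j<p. gregory j * (fdiff ^^ j) g x)) \<longlongrightarrow> 0) at_top"
proof -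
  define S where "S = indef_sum g"
  \<comment> \<open>The order used by the definition of \<open>\<Sigma>g\<close>. All statements about \<open>S\<close> are first obtained for \<open>q\<close>.\<close>
  define q where "q = (SOME p. g \<in> D_class p \<inter> K_class p)"
  have "g \<in> D_class q \<inter> K_class q"
    unfolding q_def using assms(2) by (rule someI)
  then have q: "g \<in> D_class q" "g \<in> K_class q" by auto
  have p: "g \<in> D_class p" "g \<in> K_class p" using assms(2) by auto
  have lim: "indef_sum_seq q g x \<longlonglongrightarrow> S x" if "x > 0" for x
    using indef_sum_seq_convergent[OF q that]
    unfolding S_def indef_sum_def q_def[symmetric] by (simp only: convergent_LIMSEQ_iff)
  have S: "S (x + 1) = S x + g x" if "x > 0" for x
    by (rule indef_sum_limit_add_one[OF q lim that])
  have contS: "continuous_on {0<..} S" and binet_q: "(gen_binet (Suc q) S \<longlongrightarrow> 0) at_top"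
    using indef_sum_gen_binet_tendsto_0[OF assms(1) q lim] by auto
  have fdiff_S: "(fdiff ^^ Suc j) S x = (fdiff ^^ j) g x" if "x > 0" for j x
    using S that by (rule funpow_fdiff_antidifference)
  define m where "m = min p q"
  have g_lim: "((fdiff ^^ j) g \<longlongrightarrow> 0) at_top" if "j \<ge> m" for j
    using that funpow_fdiff_tendsto_0_ge[OF funpow_fdiff_tendsto_0[OF p]]
      funpow_fdiff_tendsto_0_ge[OF funpow_fdiff_tendsto_0[OF q]]
    by (auto simp: m_def min_def split: if_splits)
  have S_lim: "((fdiff ^^ j) S \<longlongrightarrow> 0) at_top" if j: "j \<ge> Suc m" for j
  proof -
    obtain i where i: "j = Suc i" "i \<ge> m" using j by (cases j) auto
    have "\<forall>\<^sub>F x in at_top. (fdiff ^^ i) g x = (fdiff ^^ j) S x"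
      unfolding i by (rule eventually_mono[OF eventually_gt_at_top[of 0]]) (simp only: fdiff_S)
    then show ?thesis
      by (rule Lim_transform_eventually[OF g_lim[OF i(2)]])
  qed
  \<comment> \<open>Both orders are compared with \<open>Suc m\<close>, from which on the differences of \<open>S\<close> vanish at infinity.\<close>
  have binet: "(gen_binet (Suc p) S \<longlongrightarrow> 0) at_top"
    using binet_q gen_binet_tendsto_0_iff[of "Suc m" S "Suc q"] gen_binet_tendsto_0_iff[of "Suc m" S "Suc p"] S_lim
    by (simp add: m_def)
  have g_int: "\<forall>\<^sub>F y in at_top. g integrable_on {y..y+1}"
    by (rule eventually_mono[OF eventually_gt_at_top[of 0]])
      (auto intro!: integrable_continuous_real continuous_on_subset[OF assms(1)])
  have "((\<lambda>y. (fdiff ^^ p) g (y + 1) - (fdiff ^^ p) g (y + - 1)) \<longlongrightarrow> 0 - 0) at_top"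
    by (intro tendsto_diff filterlim_compose[OF _ filterlim_add_const_at_top] funpow_fdiff_tendsto_0 p)
  then have "(gen_binet (Suc p) g \<longlongrightarrow> 0) at_top"
    by (intro K_class_gen_binet_tendsto_0[OF p(2) g_int]) simp
  then have binet_g: "(gen_binet p g \<longlongrightarrow> 0) at_top"
    using gen_binet_tendsto_0_iff[of p g "Suc p"] g_lim by (simp add: m_def)
  have "gregory 0 = 1"
    by (simp add: gregory_def)
  have "((\<lambda>x. gen_binet (Suc p) S x + asymptotic_constant g) \<longlongrightarrow> 0 + asymptotic_constant g) at_top"
    by (intro tendsto_add binet tendsto_const)
  moreover have "\<forall>\<^sub>F x in at_top. gen_binet (Suc p) S x + asymptotic_constant g
      = S x - integral {1..x} g + (\<Sum>j=1..p. gregory j * (fdiff ^^ (j - 1)) g x)"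
  proof (rule eventually_mono[OF eventually_ge_at_top[of 1]])
    fix x :: real assume x: "x \<ge> 1"
    have "(\<Sum>j<Suc p. gregory j * (fdiff ^^ j) S x) = S x + (\<Sum>j=1..p. gregory j * (fdiff ^^ (j - 1)) g x)"
      unfolding sum.lessThan_Suc_shift using x \<open>gregory 0 = 1\<close>
      by (simp add: fdiff_S sum.atLeast1_atMost_eq del: funpow.simps(2))
    then show "gen_binet (Suc p) S x + asymptotic_constant g
      = S x - integral {1..x} g + (\<Sum>j=1..p. gregory j * (fdiff ^^ (j - 1)) g x)"
      using integral_unit_interval_of_fdiff[OF contS assms(1) S x]
      by (simp add: gen_binet_def asymptotic_constant_def S_def del: sum.lessThan_Suc)
  qed
  ultimately have "((\<lambda>x. S x - integral {1..x} g + (\<Sum>j=1..p. gregory j * (fdiff ^^ (j - 1)) g x))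
      \<longlongrightarrow> asymptotic_constant g) at_top"
    using Lim_transform_eventually by force
  moreover have "((\<lambda>x. integral {x..x+1} g - (\<Sum>j<p. gregory j * (fdiff ^^ j) g x)) \<longlongrightarrow> 0) at_top"
    using tendsto_minus[OF binet_g] by (simp add: gen_binet_def)
  ultimately show ?thesis
    using binet binet_g by (simp add: S_def)
qed

end
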